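(* Let $G$ be a graph of order $n$. If $G$ has an edge, then $\operatorname{th}_-(G)\le n-1$. Thus $\operatorname{th}_-(G)=n$ if and only if $G=rK_1$ for some integer $r\geq 1$ (i.e. $G$ has no edges).
   Context: Graphs are finite, simple and undirected, with nonempty vertex set. The order of a graph is its number of vertices; $rK_1$ is the graph consisting of $r$ isolated vertices. Skew zero forcing: each vertex of $G$ is blue or white; initially exactly the vertices of a set $S\subseteq V(G)$ are blue. In each round, simultaneously, every vertex (blue or white) that has exactly one white neighbor at the start of the round colors that neighbor blue. If all vertices eventually become blue, $S$ is a skew zero forcing set, and the skew propagation time $\operatorname{pt}_-(G;S)$ is the number of rounds needed until all vertices are blue ($0$ if $S=V(G)$); otherwise $\operatorname{pt}_-(G;S)=\infty$. Define $\operatorname{th}_-(G;S)=|S|+\operatorname{pt}_-(G;S)$ and the skew throttling number $\operatorname{th}_-(G)=\min_{S\subseteq V(G)}\operatorname{th}_-(G;S)$. *)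

theory Defs
  imports
    "HOL-Library.Extended_Nat"
    "Graph_Theory.Pair_Digraph"
    "Graph_Theory.Digraph_Isomorphism"
begin

text \<open>
  A finite simple undirected graph is a \<open>pair_graph\<close>: a loop-free finite digraph whose arc set is a
  symmetric set of ordered pairs, so that an edge \<open>uv\<close> is represented by the two arcs \<open>(u, v)\<close>
  and \<open>(v, u)\<close>. The locale \<open>pair_graph\<close> admits the graph without vertices.
\<close>

definition graph_order :: "'a pair_pre_digraph \<Rightarrow> nat" where
  "graph_order G = card (pverts G)"

definition neighborhood :: "'a pair_pre_digraph \<Rightarrow> 'a \<Rightarrow> 'a set" where
  "neighborhood G v = {w. (v, w) \<in> parcs G}"

text \<open>The forcing vertex \<open>v\<close> may be blue or white.\<close>

definition skew_round :: "'a pair_pre_digraph \<Rightarrow> 'a set \<Rightarrow> 'a set" where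
  "skew_round G B = B \<union> {w. \<exists>v\<in>pverts G. neighborhood G v - B = {w}}"

definition blue_after :: "'a pair_pre_digraph \<Rightarrow> 'a set \<Rightarrow> nat \<Rightarrow> 'a set" where
  "blue_after G S k = (skew_round G ^^ k) S"

definition skew_zero_forcing_set :: "'a pair_pre_digraph \<Rightarrow> 'a set \<Rightarrow> bool" where
  "skew_zero_forcing_set G S \<longleftrightarrow> S \<subseteq> pverts G \<and> (\<exists>k. blue_after G S k = pverts G)"

definition skew_propagation_time :: "'a pair_pre_digraph \<Rightarrow> 'a set \<Rightarrow> enat" where
  "skew_propagation_time G S =
     (if skew_zero_forcing_set G S then enat (LEAST k. blue_after G S k = pverts G) else \<infinity>)"

definition skew_throttling_of :: "'a pair_pre_digraph \<Rightarrow> 'a set \<Rightarrow> enat" where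
  "skew_throttling_of G S = enat (card S) + skew_propagation_time G S"

definition skew_throttling_number :: "'a pair_pre_digraph \<Rightarrow> enat" where
  "skew_throttling_number G = Min (skew_throttling_of G ` Pow (pverts G))"

definition isolated_vertices_graph :: "nat \<Rightarrow> nat pair_pre_digraph" where
  "isolated_vertices_graph r = \<lparr> pverts = {0..<r}, parcs = {} \<rparr>"

text \<open>
  Equality of graphs such as \<open>G = rK\<^sub>1\<close> is understood up to isomorphism. \<open>with_proj\<close> merely views
  a \<open>pair_pre_digraph\<close> as a general digraph, on which the library's \<open>digraph_iso\<close> is defined.
\<close>

definition graph_isomorphic :: "'a pair_pre_digraph \<Rightarrow> 'b pair_pre_digraph \<Rightarrow> bool" where
  "graph_isomorphic G H \<longleftrightarrow> digraph_iso (with_proj G) (with_proj H)"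

end

theory Submission
  imports Defs
begin

text \<open>
  If \<open>uv\<close> is an edge, colour everything except \<open>u\<close> and \<open>v\<close> blue: since white vertices may force,
  \<open>u\<close> and \<open>v\<close> force each other in the first round, at total cost \<open>(n - 2) + 1\<close>. Without edges no
  vertex ever forces, so the only skew zero forcing set is the whole vertex set.
\<close>

text \<open>The propagation time is a least round number, so any \<open>k\<close> with everything
  blue bounds it from above. Later upper bounds thus never compute an exact propagation
  time.\<close>

lemma skew_throttling_number_le:
  assumes "finite (pverts G)" "S \<subseteq> pverts G" "blue_after G S k = pverts G"
  shows "skew_throttling_number G \<le> enat (card S + k)"
proof -
  have "skew_throttling_number G \<le> skew_throttling_of G S"
    unfolding skew_throttling_number_def using assms(1,2) by (intro Min_le) auto
  also have "\<dots> \<le> enat (card S + k)"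
    using assms(2,3)
    by (auto simp: skew_throttling_of_def skew_propagation_time_def skew_zero_forcing_set_def
        intro: Least_le)
  finally show ?thesis .
qed

lemma (in pair_graph) blue_after_delete_edge:
  assumes "(u, v) \<in> parcs G"
  shows "blue_after G (pverts G - {u, v}) 1 = pverts G"
proof -
  have vu: "(v, u) \<in> parcs G"
    using pair_sym_arcs assms by (auto simp: symmetric_def dest: symD)
  have mem: "u \<in> pverts G" "v \<in> pverts G"
    using assms wellformed' by auto
  \<comment> \<open>The forcing vertex is itself white here, so without loop-freeness
    \<open>u\<close> could count as its own second white neighbor.\<close>
  have loop: "(w, w) \<notin> parcs G" for w
    using pair_no_loops by fastforce
  have "neighborhood G u - (pverts G - {u, v}) = {v}"
    "neighborhood G v - (pverts G - {u, v}) = {u}"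
    using assms vu loop wellformed' by (auto simp: neighborhood_def)
  with mem have forced: "{u, v} \<subseteq> skew_round G (pverts G - {u, v})"
    unfolding skew_round_def by blast
  have "skew_round G (pverts G - {u, v}) \<subseteq> pverts G"
    unfolding skew_round_def neighborhood_def using wellformed' by blast
  moreover have "pverts G - {u, v} \<subseteq> skew_round G (pverts G - {u, v})"
    unfolding skew_round_def by blast
  ultimately show ?thesis
    using forced by (auto simp: blue_after_def)
qed

lemma (in pair_graph) skew_throttling_number_le_if_edge:
  assumes "parcs G \<noteq> {}"
  shows "skew_throttling_number G \<le> enat (graph_order G - 1)"
proof -
  obtain u v where uv: "(u, v) \<in> parcs G"
    using assms by auto
  have edge: "{u, v} \<subseteq> pverts G" "u \<noteq> v"
    using uv wellformed' pair_no_loops by fastforce+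
  \<comment> \<open>At least two vertices exist, so the truncated subtraction in
    \<open>(n - 2) + 1 = n - 1\<close> is harmless.\<close>
  have "card {u, v} \<le> card (pverts G)"
    using edge(1) by (intro card_mono pair_finite_verts)
  with edge have "card (pverts G - {u, v}) + 1 = graph_order G - 1"
    by (simp add: card_Diff_subset graph_order_def)
  then show ?thesis
    using skew_throttling_number_le[OF pair_finite_verts _ blue_after_delete_edge[OF uv]] by simp
qed

lemma blue_after_edgeless:
  assumes "parcs G = {}"
  shows "blue_after G S k = S"
  by (induction k) (use assms in \<open>auto simp: blue_after_def skew_round_def neighborhood_def\<close>)

lemma skew_throttling_number_edgeless:
  assumes "finite (pverts G)" "parcs G = {}"
  shows "skew_throttling_number G = enat (graph_order G)"
proof (rule antisym)
  show "skew_throttling_number G \<le> enat (graph_order G)"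
    \<comment> \<open>Witness: the whole vertex set, blue after zero rounds.\<close>
    using skew_throttling_number_le[OF assms(1) order_refl, of 0]
    by (simp add: blue_after_def graph_order_def)
  show "enat (graph_order G) \<le> skew_throttling_number G"
    unfolding skew_throttling_number_def
  proof (rule Min.boundedI)
    \<comment> \<open>A proper subset stays as it is forever, so its value is
      \<open>\<infinity>\<close>; only the full set contributes a finite value.\<close>
    show "enat (graph_order G) \<le> t" if "t \<in> skew_throttling_of G ` Pow (pverts G)" for t
      using that assms(2)
      by (auto simp: skew_throttling_of_def skew_propagation_time_def skew_zero_forcing_set_def
          blue_after_edgeless graph_order_def)
  qed (use assms(1) in auto)
qed

text \<open>An edgeless graph is determined up to isomorphism by its order, so \<open>r\<close> can
  only be the order of \<open>G\<close>.\<close>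

lemma (in pair_wf_digraph) graph_isomorphic_isolated_vertices_iff:
  assumes "finite (pverts G)"
  shows "graph_isomorphic G (isolated_vertices_graph r) \<longleftrightarrow> parcs G = {} \<and> graph_order G = r"
proof
  assume "graph_isomorphic G (isolated_vertices_graph r)"
  then obtain f where f: "digraph_isomorphism f"
      "with_proj (isolated_vertices_graph r) = app_iso f (with_proj G)"
    unfolding graph_isomorphic_def digraph_iso_def by auto
  have "parcs G = {}"
    using arg_cong[OF f(2), of arcs] by (simp add: isolated_vertices_graph_def)
  moreover have "iso_verts f ` pverts G = {0..<r}"
    using arg_cong[OF f(2), of verts] by (simp add: isolated_vertices_graph_def)
  then have "graph_order G = r"
    using card_image[OF digraph_isomorphism_inj_on_verts[OF f(1)]] by (simp add: graph_order_def)
  ultimately show "parcs G = {} \<and> graph_order G = r" ..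
next
  assume *: "parcs G = {} \<and> graph_order G = r"
  then obtain h where h: "bij_betw h (pverts G) {0..<r}"
    using ex_bij_betw_finite_nat[OF assms] by (auto simp: graph_order_def)
  \<comment> \<open>\<open>app_iso\<close> takes its head and tail maps from the isomorphism; they
    must be the projections used by \<open>with_proj\<close> for the records to be equal.\<close>
  let ?f = "\<lparr>iso_verts = h, iso_arcs = map_prod h h, iso_head = snd, iso_tail = fst\<rparr>"
  have "digraph_isomorphism ?f"
    using * h wf_digraph by (simp add: digraph_isomorphism_def bij_betw_def)
  moreover have "with_proj (isolated_vertices_graph r) = app_iso ?f (with_proj G)"
    using * h by (simp add: with_proj_def app_iso_def isolated_vertices_graph_def bij_betw_def)
  ultimately show "graph_isomorphic G (isolated_vertices_graph r)"
    unfolding graph_isomorphic_def digraph_iso_def by blast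
qed

theorem proposition2p5:
  fixes G :: "'a pair_pre_digraph" and n :: nat
  assumes "pair_graph G"
    and "pverts G \<noteq> {}"
    and "graph_order G = n"
  shows "(parcs G \<noteq> {} \<longrightarrow> skew_throttling_number G \<le> enat (n - 1)) \<and>
         (skew_throttling_number G = enat n \<longleftrightarrow>
            (\<exists>r\<ge>1. graph_isomorphic G (isolated_vertices_graph r))) \<and>
         (skew_throttling_number G = enat n \<longleftrightarrow> parcs G = {})"
proof -
  interpret pair_graph G by fact
  \<comment> \<open>This makes \<open>n - 1\<close> strictly smaller than \<open>n\<close> and lets
    \<open>r = n\<close> satisfy \<open>r \<ge> 1\<close>.\<close>
  have pos: "n \<ge> 1"
    using assms(2,3) pair_finite_verts by (auto simp: graph_order_def Suc_le_eq card_gt_0_iff)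
  have le: "skew_throttling_number G \<le> enat (n - 1)" if "parcs G \<noteq> {}"
    using skew_throttling_number_le_if_edge[OF that] assms(3) by simp
  have "skew_throttling_number G = enat n \<longleftrightarrow> parcs G = {}"
    using le pos skew_throttling_number_edgeless[OF pair_finite_verts] assms(3) by fastforce
  with le pos show ?thesis
    using graph_isomorphic_isolated_vertices_iff[OF pair_finite_verts] assms(3) by auto
qed

end
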